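(* Let $X$ be a Banach space with $\dim X\ge 2$, let $0\le\alpha\le\frac12$ and $1\le p<\infty$. Then $$(1-\alpha)^p+\alpha^p\le C^I_{NJ}(\alpha,p,X)\le 2(1-\alpha)^p.$$
   Context: For $x_1,x_2\in X$, isosceles orthogonality $x_1\perp_I x_2$ means $\|x_1+x_2\|=\|x_1-x_2\|$. For $1\le p<\infty$ and $0\le\alpha\le\frac12$, $$C^{I}_{NJ}(\alpha,p,X)=\sup\left\{\frac{\|\alpha x_1+(1-\alpha)x_2\|^{p}+\|(1-\alpha)x_1+\alpha x_2\|^{p}}{\|x_1+x_2\|^{p}}: x_1,x_2\in X,\ (x_1,x_2)\neq(0,0),\ x_1\perp_I x_2\right\}.$$ *)

theory Defs
  imports Complex_Main "HOL-Library.Extended_Real"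
begin

definition isosceles_orthogonal :: "'a::real_normed_vector \<Rightarrow> 'a \<Rightarrow> bool"  (infix "\<bottom>\<^sub>I" 50)
  where "x \<bottom>\<^sub>I y \<longleftrightarrow> norm (x + y) = norm (x - y)"

(* The supremum is taken in the extended reals, so that it is meaningful whether or not
   the set of quotients is known to be bounded. The quotients never divide by zero:
   x1 + x2 = 0 together with isosceles orthogonality forces x1 = x2 = 0. *)
definition C_NJ_I :: "real \<Rightarrow> real \<Rightarrow> 'a::real_normed_vector itself \<Rightarrow> ereal"
  where "C_NJ_I \<alpha> p X =
    Sup {ereal ((norm (\<alpha> *\<^sub>R x1 + (1 - \<alpha>) *\<^sub>R x2) powr p
                  + norm ((1 - \<alpha>) *\<^sub>R x1 + \<alpha> *\<^sub>R x2) powr p)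
                / norm (x1 + x2) powr p)
         | x1 x2 :: 'a. (x1, x2) \<noteq> (0, 0) \<and> x1 \<bottom>\<^sub>I x2}"

(* Stated through independent sets because the library's dim is 0 in infinite dimension. *)
definition dim_at_least :: "nat \<Rightarrow> 'a::real_vector itself \<Rightarrow> bool"
  where "dim_at_least n X \<longleftrightarrow> (\<exists>S :: 'a set. finite S \<and> independent S \<and> card S = n)"

end

theory Submission imports Defs begin

text \<open>The lower bound is the quotient at a pair \<open>(x, 0)\<close>. For the upper bound, write
  \<open>\<alpha> x\<^sub>1 + (1 - \<alpha>) x\<^sub>2 = (x\<^sub>1 + x\<^sub>2)/2 - (1 - 2\<alpha>)(x\<^sub>1 - x\<^sub>2)/2\<close> and use that the two vectors
  \<open>x\<^sub>1 + x\<^sub>2\<close> and \<open>x\<^sub>1 - x\<^sub>2\<close> have the same norm.\<close>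

lemma isosceles_orthogonal_commute: "x \<bottom>\<^sub>I y \<Longrightarrow> y \<bottom>\<^sub>I x"
  by (simp add: isosceles_orthogonal_def add.commute norm_minus_commute)

lemma isosceles_orthogonal_norm_convex_le:
  fixes x y :: "'a::real_normed_vector"
  assumes "x \<bottom>\<^sub>I y" and "\<alpha> \<le> 1 / 2"
  shows "norm (\<alpha> *\<^sub>R x + (1 - \<alpha>) *\<^sub>R y) \<le> (1 - \<alpha>) * norm (x + y)"
proof -
  have "\<alpha> *\<^sub>R x + (1 - \<alpha>) *\<^sub>R y = (1/2) *\<^sub>R (x + y) - ((1 - 2 * \<alpha>) / 2) *\<^sub>R (x - y)"
  proof -
    \<comment> \<open>Splitting both weights symmetrically about 1/2 makes the identity a plain
      linear expansion in \<open>x\<close> and \<open>y\<close>.\<close>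
    have "\<alpha> = 1/2 - (1 - 2 * \<alpha>) / 2" and "1 - \<alpha> = 1/2 + (1 - 2 * \<alpha>) / 2"
      by (simp_all add: field_simps)
    then have "\<alpha> *\<^sub>R x + (1 - \<alpha>) *\<^sub>R y
      = (1/2 - (1 - 2 * \<alpha>) / 2) *\<^sub>R x + (1/2 + (1 - 2 * \<alpha>) / 2) *\<^sub>R y"
      by presburger
    also have "\<dots> = (1/2) *\<^sub>R (x + y) - ((1 - 2 * \<alpha>) / 2) *\<^sub>R (x - y)"
      by (simp only: scaleR_add_right scaleR_diff_right scaleR_add_left scaleR_diff_left) simp
    finally show ?thesis .
  qed
  also have "norm \<dots> \<le> norm ((1/2) *\<^sub>R (x + y)) + norm (((1 - 2 * \<alpha>) / 2) *\<^sub>R (x - y))"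
    by (rule norm_triangle_ineq4)
  \<comment> \<open>Since \<alpha> \<le> 1/2, the factor \<open>(1 - 2 * \<alpha>) / 2\<close> is
    nonnegative and leaves the norm without an absolute value.\<close>
  also have "\<dots> = (1/2) * norm (x + y) + ((1 - 2 * \<alpha>) / 2) * norm (x - y)"
    using assms(2) by simp
  also have "\<dots> = (1 - \<alpha>) * norm (x + y)"
    using assms(1) by (simp add: isosceles_orthogonal_def field_simps)
  finally show ?thesis .
qed

text \<open>If the sum vanishes, orthogonality forces \<open>norm (x - y) = 0\<close>, so
  \<open>x = y\<close> and \<open>2 *\<^sub>R y = 0\<close>. This keeps the denominators of the
  quotients positive.\<close>

lemma isosceles_orthogonal_add_eq_0:
  fixes x y :: "'a::real_normed_vector"
  assumes "x \<bottom>\<^sub>I y" and "x + y = 0"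
  shows "x = 0" and "y = 0"
proof -
  have "x = y"
    using assms by (simp add: isosceles_orthogonal_def)
  moreover from this have "2 *\<^sub>R y = 0"
    using assms(2) by (simp add: scaleR_2)
  ultimately show "x = 0" and "y = 0"
    by auto
qed

text \<open>A nonempty independent set cannot contain 0. This turns the dimension hypothesis into a
  witness for the lower bound.\<close>

lemma dim_at_least_ex_nonzero:
  assumes "dim_at_least n TYPE('a::real_vector)" and "0 < n"
  shows "\<exists>x :: 'a. x \<noteq> 0"
proof -
  obtain S :: "'a set" where "independent S" and "card S = n"
    using assms(1) by (auto simp: dim_at_least_def)
  then have "S \<noteq> {}" and "0 \<notin> S"
    using assms(2) dependent_zero by auto
  then show ?thesis
    by (metis ex_in_conv)
qed

lemma C_NJ_I_lower:
  assumes "\<exists>x :: 'a::real_normed_vector. x \<noteq> 0"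
    and "0 \<le> \<alpha>" and "\<alpha> \<le> 1"
  shows "ereal ((1 - \<alpha>) powr p + \<alpha> powr p) \<le> C_NJ_I \<alpha> p TYPE('a)"
proof -
  obtain x :: 'a where "x \<noteq> 0"
    using assms(1) by blast
  \<comment> \<open>Both weights are nonnegative, so they come out of the norms and
    \<open>norm x powr p\<close> cancels. At \<alpha> = 0 both sides use
    \<open>0 powr p = 0\<close>.\<close>
  then have "(1 - \<alpha>) powr p + \<alpha> powr p =
      (norm (\<alpha> *\<^sub>R x + (1 - \<alpha>) *\<^sub>R 0) powr p + norm ((1 - \<alpha>) *\<^sub>R x + \<alpha> *\<^sub>R 0) powr p)
        / norm (x + 0) powr p"
    using assms(2,3) by (simp add: powr_mult add_divide_distrib)
  moreover have "x \<bottom>\<^sub>I 0"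
    by (simp add: isosceles_orthogonal_def)
  ultimately show ?thesis
    unfolding C_NJ_I_def using \<open>x \<noteq> 0\<close> by (intro Sup_upper) blast
qed

lemma C_NJ_I_upper:
  assumes "\<alpha> \<le> 1 / 2" and "0 \<le> p"
  shows "C_NJ_I \<alpha> p TYPE('a::real_normed_vector) \<le> ereal (2 * (1 - \<alpha>) powr p)"
  unfolding C_NJ_I_def
proof (rule Sup_least, elim CollectE exE conjE, hypsubst)
  fix x y :: 'a
  assume nz: "(x, y) \<noteq> (0, 0)" and orth: "x \<bottom>\<^sub>I y"
  define N where "N = norm (x + y) powr p"
  have "x + y \<noteq> 0"
    using nz isosceles_orthogonal_add_eq_0[OF orth] by auto
  then have "N > 0"
    by (simp add: N_def)
  have "norm (\<alpha> *\<^sub>R x + (1 - \<alpha>) *\<^sub>R y) powr p \<le> ((1 - \<alpha>) * norm (x + y)) powr p"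
    using isosceles_orthogonal_norm_convex_le[OF orth assms(1)] assms(2)
    by (intro powr_mono2) auto
  \<comment> \<open>The second numerator term is the first with \<open>x\<close> and
    \<open>y\<close> exchanged, and orthogonality is symmetric.\<close>
  moreover have "norm ((1 - \<alpha>) *\<^sub>R x + \<alpha> *\<^sub>R y) powr p \<le> ((1 - \<alpha>) * norm (x + y)) powr p"
    using isosceles_orthogonal_norm_convex_le[OF isosceles_orthogonal_commute[OF orth] assms(1)]
      assms(2)
    by (intro powr_mono2) (auto simp: add.commute)
  moreover have "((1 - \<alpha>) * norm (x + y)) powr p = (1 - \<alpha>) powr p * N"
    using assms(1) by (simp add: N_def powr_mult)
  ultimately have "norm (\<alpha> *\<^sub>R x + (1 - \<alpha>) *\<^sub>R y) powr p + norm ((1 - \<alpha>) *\<^sub>R x + \<alpha> *\<^sub>R y) powr p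
      \<le> 2 * (1 - \<alpha>) powr p * N"
    by simp
  then show "ereal ((norm (\<alpha> *\<^sub>R x + (1 - \<alpha>) *\<^sub>R y) powr p
      + norm ((1 - \<alpha>) *\<^sub>R x + \<alpha> *\<^sub>R y) powr p) / norm (x + y) powr p)
      \<le> ereal (2 * (1 - \<alpha>) powr p)"
    using \<open>N > 0\<close> by (simp add: N_def[symmetric] pos_divide_le_eq)
qed

theorem proposition3:
  fixes \<alpha> p :: real
  assumes "dim_at_least 2 TYPE('a::banach)"
    and "0 \<le> \<alpha>" and "\<alpha> \<le> 1 / 2" and "1 \<le> p"
  shows "ereal ((1 - \<alpha>) powr p + \<alpha> powr p) \<le> C_NJ_I \<alpha> p TYPE('a)
    \<and> C_NJ_I \<alpha> p TYPE('a) \<le> ereal (2 * (1 - \<alpha>) powr p)"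
  using C_NJ_I_lower[OF dim_at_least_ex_nonzero[OF assms(1)], of \<alpha> p]
    C_NJ_I_upper[of \<alpha> p, where 'a = 'a] assms(2-4)
  by simp

end
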